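(* An MU-category $\mathcal{K}$ has a Fraïssé sequence if and only if it is a Fraïssé MU-category.
   Context: An $\infty$-metric is a metric allowed to take the value $\infty$. An MU-category is a category $\mathcal{K}$ with an $\infty$-metric $d$ on every hom-set such that (1) $d(g\circ f,h\circ f)\le d(g,h)$ for all $\mathcal{K}$-maps $f$ and all compatible $g,h$, and (2) for every $\mathcal{K}$-map $f$ and $\varepsilon>0$ there is $\delta>0$ such that for every object $W$ and all $g,h\colon W\to\mathrm{dom}(f)$, $d(g,h)<\delta$ implies $d(f\circ g,f\circ h)<\varepsilon$. We write $f\approx_\varepsilon g$ for $d(f,g)<\varepsilon$. A sequence $\langle X_*,f_*\rangle$ in $\mathcal{K}$ consists of $\mathcal{K}$-objects $X_n$ and $\mathcal{K}$-maps $f_n\colon X_{n+1}\to X_n$, $n\in\omega$; $f_{n,n'}=f_n\circ\cdots\circ f_{n'-1}\colon X_{n'}\to X_n$ for $n\le n'$. The sequence is Fraïssé if it is: cofinal (for every $\mathcal{K}$-object $Y$ there is $n$ and a $\mathcal{K}$-map $X_n\to Y$), absorbing (for every $n$, $\varepsilon>0$ and $\mathcal{K}$-map $f\colon Y\to X_n$ there is $n'\ge n$ and a $\mathcal{K}$-map $g\colon X_{n'}\to Y$ with $f\circ g\approx_\varepsilon f_{n,n'}$), and projective (for every $\varepsilon>0$ and $\mathcal{K}$-maps $f\colon X_n\to Z$, $g\colon Y\to Z$ there is $n'\ge n$ and a $\mathcal{K}$-map $g'\colon X_{n'}\to Y$ with $f\circ f_{n,n'}\approx_\varepsilon g\circ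 g'$). A subcategory $\mathcal{D}\subseteq\mathcal{K}$ is dominating if it is cofinal (for every $\mathcal{K}$-object $X$ there is a $\mathcal{K}$-map $Y\to X$ from a $\mathcal{D}$-object $Y$) and absorbing (for every $\mathcal{D}$-object $X$, every $\varepsilon>0$, and every $\mathcal{K}$-map $f\colon Y\to X$ there is a $\mathcal{K}$-map $g\colon Z\to Y$ and a $\mathcal{D}$-map $h\colon Z\to X$ with $f\circ g\approx_\varepsilon h$). A non-empty MU-category $\mathcal{K}$ is Fraïssé if: it is directed (for all $\mathcal{K}$-objects $X,Y$ there is a $\mathcal{K}$-object $Z$ with $\mathcal{K}$-maps $Z\to X$ and $Z\to Y$); it has the amalgamation property (for every $\varepsilon>0$ and $\mathcal{K}$-maps $f\colon X\to Z$, $g\colon Y\to Z$ there are a $\mathcal{K}$-object $W$ and $\mathcal{K}$-maps $f'\colon W\to X$, $g'\colon W\to Y$ with $f\circ f'\approx_\varepsilon g\circ g'$); and it has a countable dominating subcategory (countable meaning with countably many morphisms). *)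

theory Defs
  imports "HOL-Library.Extended_Nonnegative_Real" "HOL-Library.Countable_Set"
begin

section \<open>MU-categories\<close>

text \<open>
  Objects and morphisms are carrier sets inside types; the values of the operations outside the
  carriers are irrelevant. The composite \<open>g \<cdot>\<^bsub>K\<^esub> f\<close> is in applicative order (first \<open>f\<close>, then \<open>g\<close>).
  \<open>Dist\<close> is meaningful only for two morphisms of a common hom-set.
\<close>

record ('o, 'm) mucat =
  Ob :: "'o set"
  Mor :: "'m set"
  Dom :: "'m \<Rightarrow> 'o"
  Cod :: "'m \<Rightarrow> 'o"
  Ident :: "'o \<Rightarrow> 'm"
  Comp :: "'m \<Rightarrow> 'm \<Rightarrow> 'm" (infixl \<open>\<cdot>\<index>\<close> 70)
  Dist :: "'m \<Rightarrow> 'm \<Rightarrow> ennreal"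

definition Hom :: "('o, 'm) mucat \<Rightarrow> 'o \<Rightarrow> 'o \<Rightarrow> 'm set" where
  "Hom K X Y = {f \<in> Mor K. Dom K f = X \<and> Cod K f = Y}"

locale category =
  fixes K :: "('o, 'm) mucat" (structure)
  assumes Dom_Ob: "f \<in> Mor K \<Longrightarrow> Dom K f \<in> Ob K"
    and Cod_Ob: "f \<in> Mor K \<Longrightarrow> Cod K f \<in> Ob K"
    and Ident_Hom: "X \<in> Ob K \<Longrightarrow> Ident K X \<in> Hom K X X"
    and Comp_Hom: "\<lbrakk>f \<in> Hom K X Y; g \<in> Hom K Y Z\<rbrakk> \<Longrightarrow> g \<cdot> f \<in> Hom K X Z"
    and Comp_Ident_right: "f \<in> Hom K X Y \<Longrightarrow> f \<cdot> Ident K X = f"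
    and Comp_Ident_left: "f \<in> Hom K X Y \<Longrightarrow> Ident K Y \<cdot> f = f"
    and Comp_assoc: "\<lbrakk>f \<in> Hom K W X; g \<in> Hom K X Y; h \<in> Hom K Y Z\<rbrakk>
          \<Longrightarrow> (h \<cdot> g) \<cdot> f = h \<cdot> (g \<cdot> f)"

locale infinity_metric =
  fixes S :: "'a set" and d :: "'a \<Rightarrow> 'a \<Rightarrow> ennreal"
  assumes zero_iff: "\<lbrakk>x \<in> S; y \<in> S\<rbrakk> \<Longrightarrow> d x y = 0 \<longleftrightarrow> x = y"
    and commute: "\<lbrakk>x \<in> S; y \<in> S\<rbrakk> \<Longrightarrow> d x y = d y x"
    and triangle: "\<lbrakk>x \<in> S; y \<in> S; z \<in> S\<rbrakk> \<Longrightarrow> d x z \<le> d x y + d y z"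

locale MU_category = category K
  for K :: "('o, 'm) mucat" (structure) +
  assumes Dist_metric: "\<lbrakk>X \<in> Ob K; Y \<in> Ob K\<rbrakk> \<Longrightarrow> infinity_metric (Hom K X Y) (Dist K)"
    and Comp_right_nonexpansive:
      "\<lbrakk>f \<in> Hom K X Y; g \<in> Hom K Y Z; h \<in> Hom K Y Z\<rbrakk>
        \<Longrightarrow> Dist K (g \<cdot> f) (h \<cdot> f) \<le> Dist K g h"
    and Comp_left_uniformly_continuous:
      "\<lbrakk>f \<in> Hom K X Y; (\<epsilon>::real) > 0\<rbrakk>
        \<Longrightarrow> \<exists>\<delta>::real. \<delta> > 0 \<and> (\<forall>W \<in> Ob K. \<forall>g \<in> Hom K W X. \<forall>h \<in> Hom K W X.
              Dist K g h < ennreal \<delta> \<longrightarrow> Dist K (f \<cdot> g) (f \<cdot> h) < ennreal \<epsilon>)"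

text \<open>Approximate equality, used only for morphisms of a common hom-set.\<close>

definition approx :: "('o, 'm) mucat \<Rightarrow> real \<Rightarrow> 'm \<Rightarrow> 'm \<Rightarrow> bool" where
  "approx K \<epsilon> f g \<longleftrightarrow> Dist K f g < ennreal \<epsilon>"


section \<open>Fraisse sequences\<close>

definition is_sequence :: "('o, 'm) mucat \<Rightarrow> (nat \<Rightarrow> 'o) \<Rightarrow> (nat \<Rightarrow> 'm) \<Rightarrow> bool" where
  "is_sequence K X f \<longleftrightarrow> (\<forall>n. X n \<in> Ob K) \<and> (\<forall>n. f n \<in> Hom K (X (Suc n)) (X n))"

text \<open>
  For \<open>n \<le> n'\<close>, \<open>bond K X f n n'\<close> is the composite of \<open>f n, \<dots>, f (n' - 1)\<close>, from \<open>X n'\<close> to \<open>X n\<close>,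
  and the identity of \<open>X n\<close> if \<open>n = n'\<close>; for \<open>n' < n\<close> its value is junk.
\<close>

primrec bond :: "('o, 'm) mucat \<Rightarrow> (nat \<Rightarrow> 'o) \<Rightarrow> (nat \<Rightarrow> 'm) \<Rightarrow> nat \<Rightarrow> nat \<Rightarrow> 'm" where
  "bond K X f n 0 = Ident K (X n)"
| "bond K X f n (Suc m) = (if n \<le> m then bond K X f n m \<cdot>\<^bsub>K\<^esub> f m else Ident K (X n))"

definition seq_cofinal :: "('o, 'm) mucat \<Rightarrow> (nat \<Rightarrow> 'o) \<Rightarrow> bool" where
  "seq_cofinal K X \<longleftrightarrow> (\<forall>Y \<in> Ob K. \<exists>n. \<exists>g. g \<in> Hom K (X n) Y)"

definition seq_absorbing :: "('o, 'm) mucat \<Rightarrow> (nat \<Rightarrow> 'o) \<Rightarrow> (nat \<Rightarrow> 'm) \<Rightarrow> bool" where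
  "seq_absorbing K X f \<longleftrightarrow>
    (\<forall>n. \<forall>\<epsilon>::real. \<epsilon> > 0 \<longrightarrow> (\<forall>Y \<in> Ob K. \<forall>g \<in> Hom K Y (X n).
      \<exists>n' \<ge> n. \<exists>h \<in> Hom K (X n') Y. approx K \<epsilon> (g \<cdot>\<^bsub>K\<^esub> h) (bond K X f n n')))"

definition seq_projective :: "('o, 'm) mucat \<Rightarrow> (nat \<Rightarrow> 'o) \<Rightarrow> (nat \<Rightarrow> 'm) \<Rightarrow> bool" where
  "seq_projective K X f \<longleftrightarrow>
    (\<forall>\<epsilon>::real. \<epsilon> > 0 \<longrightarrow> (\<forall>n. \<forall>Y \<in> Ob K. \<forall>Z \<in> Ob K. \<forall>p \<in> Hom K (X n) Z. \<forall>g \<in> Hom K Y Z.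
      \<exists>n' \<ge> n. \<exists>g' \<in> Hom K (X n') Y.
        approx K \<epsilon> (p \<cdot>\<^bsub>K\<^esub> bond K X f n n') (g \<cdot>\<^bsub>K\<^esub> g')))"

definition fraisse_sequence :: "('o, 'm) mucat \<Rightarrow> (nat \<Rightarrow> 'o) \<Rightarrow> (nat \<Rightarrow> 'm) \<Rightarrow> bool" where
  "fraisse_sequence K X f \<longleftrightarrow>
    is_sequence K X f \<and> seq_cofinal K X \<and> seq_absorbing K X f \<and> seq_projective K X f"


section \<open>Fraisse MU-categories\<close>

text \<open>A subcategory is given by its set \<open>A\<close> of objects and its set \<open>M\<close> of morphisms.\<close>

definition subcategory :: "('o, 'm) mucat \<Rightarrow> 'o set \<Rightarrow> 'm set \<Rightarrow> bool" where
  "subcategory K A M \<longleftrightarrow>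
    A \<subseteq> Ob K \<and> M \<subseteq> Mor K \<and>
    (\<forall>f \<in> M. Dom K f \<in> A \<and> Cod K f \<in> A) \<and>
    (\<forall>X \<in> A. Ident K X \<in> M) \<and>
    (\<forall>f \<in> M. \<forall>g \<in> M. Cod K f = Dom K g \<longrightarrow> g \<cdot>\<^bsub>K\<^esub> f \<in> M)"

definition subcat_cofinal :: "('o, 'm) mucat \<Rightarrow> 'o set \<Rightarrow> bool" where
  "subcat_cofinal K A \<longleftrightarrow> (\<forall>X \<in> Ob K. \<exists>Y \<in> A. \<exists>g. g \<in> Hom K Y X)"

definition subcat_absorbing :: "('o, 'm) mucat \<Rightarrow> 'o set \<Rightarrow> 'm set \<Rightarrow> bool" where
  "subcat_absorbing K A M \<longleftrightarrow>
    (\<forall>X \<in> A. \<forall>\<epsilon>::real. \<epsilon> > 0 \<longrightarrow> (\<forall>Y \<in> Ob K. \<forall>f \<in> Hom K Y X.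
      \<exists>Z \<in> Ob K. \<exists>g \<in> Hom K Z Y. \<exists>h \<in> Hom K Z X \<inter> M. approx K \<epsilon> (f \<cdot>\<^bsub>K\<^esub> g) h))"

definition dominating_subcategory :: "('o, 'm) mucat \<Rightarrow> 'o set \<Rightarrow> 'm set \<Rightarrow> bool" where
  "dominating_subcategory K A M \<longleftrightarrow>
    subcategory K A M \<and> subcat_cofinal K A \<and> subcat_absorbing K A M"

definition directed_category :: "('o, 'm) mucat \<Rightarrow> bool" where
  "directed_category K \<longleftrightarrow>
    (\<forall>X \<in> Ob K. \<forall>Y \<in> Ob K. \<exists>Z \<in> Ob K. \<exists>f g. f \<in> Hom K Z X \<and> g \<in> Hom K Z Y)"

definition amalgamation_property :: "('o, 'm) mucat \<Rightarrow> bool" where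
  "amalgamation_property K \<longleftrightarrow>
    (\<forall>\<epsilon>::real. \<epsilon> > 0 \<longrightarrow>
      (\<forall>X \<in> Ob K. \<forall>Y \<in> Ob K. \<forall>Z \<in> Ob K. \<forall>f \<in> Hom K X Z. \<forall>g \<in> Hom K Y Z.
        \<exists>W \<in> Ob K. \<exists>f' \<in> Hom K W X. \<exists>g' \<in> Hom K W Y.
          approx K \<epsilon> (f \<cdot>\<^bsub>K\<^esub> f') (g \<cdot>\<^bsub>K\<^esub> g')))"

definition fraisse_MU_category :: "('o, 'm) mucat \<Rightarrow> bool" where
  "fraisse_MU_category K \<longleftrightarrow>
    MU_category K \<and> Ob K \<noteq> {} \<and> directed_category K \<and> amalgamation_property K \<and>
    (\<exists>A M. dominating_subcategory K A M \<and> countable M)"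

end

theory Submission
  imports Defs
begin

text \<open>
  Given a Fraisse sequence, its objects and the composites of its bonding maps form a countable
  dominating subcategory, and projectivity yields amalgamation.

  Conversely, once amalgamation and directedness are available, a sequence is Fraisse as soon as
  it absorbs, up to \<open>1 / (j + 1)\<close>, every map of the countable dominating subcategory into one of
  its objects. These are countably many requirements, which a recursion meets one at a time.
\<close>

section \<open>Categories and approximate equality\<close>

context category
begin

lemma Hom_ObD:
  assumes "f \<in> Hom K X Y"
  shows "X \<in> Ob K" "Y \<in> Ob K"
  using assms Dom_Ob Cod_Ob by (auto simp: Hom_def)

lemma bond_Hom:
  assumes "is_sequence K X f" "n \<le> m"
  shows "bond K X f n m \<in> Hom K (X m) (X n)"
  using assms(2)
proof (induction m rule: dec_induct)
  case base
  \<comment> \<open>For \<open>n = Suc m\<close> the test \<open>n \<le> m\<close> fails, so both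
    defining clauses give the identity.\<close>
  have "bond K X f n n = Ident K (X n)" by (cases n) auto
  then show ?case using assms(1) Ident_Hom by (auto simp: is_sequence_def)
next
  case (step m)
  moreover have "f m \<in> Hom K (X (Suc m)) (X m)" using assms(1) by (auto simp: is_sequence_def)
  ultimately show ?case using Comp_Hom by auto
qed

end

context MU_category
begin

lemma approx_sym:
  assumes "f \<in> Hom K X Y" "g \<in> Hom K X Y" "approx K \<epsilon> f g"
  shows "approx K \<epsilon> g f"
proof -
  interpret infinity_metric "Hom K X Y" "Dist K"
    using Dist_metric Hom_ObD assms(1) by blast
  show ?thesis using assms commute by (auto simp: approx_def)
qed

lemma approx_trans:
  assumes "f \<in> Hom K X Y" "g \<in> Hom K X Y" "h \<in> Hom K X Y"
    and "approx K \<delta> f g" "approx K \<epsilon> g h" "\<delta> > 0" "\<epsilon> > 0"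
  shows "approx K (\<delta> + \<epsilon>) f h"
proof -
  interpret infinity_metric "Hom K X Y" "Dist K"
    using Dist_metric Hom_ObD assms(1) by blast
  have "Dist K f h \<le> Dist K f g + Dist K g h" using triangle assms by blast
  also have "\<dots> < ennreal \<delta> + ennreal \<epsilon>"
    using assms by (intro add_strict_mono) (auto simp: approx_def)
  also have "\<dots> = ennreal (\<delta> + \<epsilon>)" using assms by (simp add: ennreal_plus)
  finally show ?thesis by (simp add: approx_def)
qed

lemma approx_comp_right:
  assumes "f \<in> Hom K X Y" "g \<in> Hom K Y Z" "h \<in> Hom K Y Z" "approx K \<epsilon> g h"
  shows "approx K \<epsilon> (g \<cdot> f) (h \<cdot> f)"
  using Comp_right_nonexpansive[OF assms(1-3)] assms(4) by (auto simp: approx_def)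

lemma approx_comp_left:
  assumes "f \<in> Hom K X Y" "\<epsilon> > 0"
  obtains \<delta> where "\<delta> > 0"
    "\<And>W g h. \<lbrakk>g \<in> Hom K W X; h \<in> Hom K W X; approx K \<delta> g h\<rbrakk> \<Longrightarrow> approx K \<epsilon> (f \<cdot> g) (f \<cdot> h)"
proof -
  from Comp_left_uniformly_continuous[OF assms] obtain \<delta> where "\<delta> > 0"
    "\<forall>W\<in>Ob K. \<forall>g\<in>Hom K W X. \<forall>h\<in>Hom K W X.
       Dist K g h < ennreal \<delta> \<longrightarrow> Dist K (f \<cdot> g) (f \<cdot> h) < ennreal \<epsilon>" by auto
  then show thesis using that[of \<delta>] Hom_ObD unfolding approx_def by meson
qed

end


section \<open>From a Fraisse sequence to a Fraisse category\<close>

text \<open>A sequence may repeat objects, so the bonding maps alone need not be closed under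
  composition. The side condition of \<open>Comp\<close> therefore compares objects rather than
  indices.\<close>

inductive_set seq_maps :: "('o, 'm) mucat \<Rightarrow> (nat \<Rightarrow> 'o) \<Rightarrow> (nat \<Rightarrow> 'm) \<Rightarrow> 'm set"
  for K :: "('o, 'm) mucat" and X f where
  Ident: "Ident K (X n) \<in> seq_maps K X f"
| Comp: "\<lbrakk>h \<in> seq_maps K X f; Cod K h = X (Suc i)\<rbrakk> \<Longrightarrow> f i \<cdot>\<^bsub>K\<^esub> h \<in> seq_maps K X f"

lemma countable_seq_maps: "countable (seq_maps K X f)"
proof -
  \<comment> \<open>\<open>word\<close> ignores composability: it is total on a countable type, and
    its range only has to contain \<open>seq_maps\<close>.\<close>
  define word where "word = (\<lambda>(ns, n). foldr (\<lambda>i h. f i \<cdot>\<^bsub>K\<^esub> h) ns (Ident K (X n)))"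
  have "h \<in> range word" if "h \<in> seq_maps K X f" for h
    using that
  proof induction
    case (Ident n)
    have "Ident K (X n) = word ([], n)" by (simp add: word_def)
    then show ?case by blast
  next
    case (Comp h i)
    then obtain ns n where "h = word (ns, n)" by auto
    then have "f i \<cdot>\<^bsub>K\<^esub> h = word (i # ns, n)" by (simp add: word_def)
    then show ?case by blast
  qed
  then have "seq_maps K X f \<subseteq> range word" by blast
  then show ?thesis by (rule countable_subset) simp
qed

lemma (in category) seq_maps_Hom:
  assumes "is_sequence K X f" "h \<in> seq_maps K X f"
  shows "\<exists>m n. h \<in> Hom K (X m) (X n)"
  using assms(2)
proof induction
  case (Ident n)
  then show ?case using assms(1) Ident_Hom by (auto simp: is_sequence_def)
next
  case (Comp h i)
  then obtain m where "h \<in> Hom K (X m) (X (Suc i))" by (auto simp: Hom_def)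
  then show ?case using assms(1) Comp_Hom unfolding is_sequence_def by blast
qed

text \<open>Words grow on the left, so the induction runs over the left factor; associativity moves
  its outermost \<open>f i\<close> outside the composite.\<close>

lemma (in category) seq_maps_Comp:
  assumes seq: "is_sequence K X f"
    and "h \<in> seq_maps K X f" "g \<in> seq_maps K X f" "Cod K g = Dom K h"
  shows "h \<cdot> g \<in> seq_maps K X f"
  using assms(2,4)
proof induction
  case (Ident n)
  obtain m l where g: "g \<in> Hom K (X m) (X l)" using seq_maps_Hom[OF seq assms(3)] by blast
  moreover have "Ident K (X n) \<in> Hom K (X n) (X n)"
    using seq Ident_Hom by (auto simp: is_sequence_def)
  ultimately have "X l = X n" using Ident.prems by (auto simp: Hom_def)
  then have "Ident K (X n) \<cdot> g = g" using g Comp_Ident_left by auto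
  then show ?case using assms(3) by simp
next
  case (Comp h i)
  obtain m l where g: "g \<in> Hom K (X m) (X l)" using seq_maps_Hom[OF seq assms(3)] by blast
  obtain k where h: "h \<in> Hom K (X k) (X (Suc i))"
    using seq_maps_Hom[OF seq Comp.hyps(1)] Comp.hyps(2) by (auto simp: Hom_def)
  have f: "f i \<in> Hom K (X (Suc i)) (X i)" using seq by (auto simp: is_sequence_def)
  have "f i \<cdot> h \<in> Hom K (X k) (X i)" using Comp_Hom h f by blast
  then have dom: "Cod K g = Dom K h" "X l = X k"
    using Comp.prems h g by (auto simp: Hom_def)
  then have gk: "g \<in> Hom K (X m) (X k)" using g by simp
  have "h \<cdot> g \<in> Hom K (X m) (X (Suc i))" using Comp_Hom gk h by blast
  then have "f i \<cdot> (h \<cdot> g) \<in> seq_maps K X f"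
    using Comp.IH[OF dom(1)] by (intro seq_maps.Comp) (auto simp: Hom_def)
  then show ?case using Comp_assoc[OF gk h f] by simp
qed

text \<open>\<open>bond\<close> grows on the right but \<open>seq_maps\<close> on the left. So each
  single \<open>f m\<close> is first put into \<open>seq_maps\<close>, as \<open>f m\<close> after
  an identity, and closure under composition does the rest.\<close>

lemma (in category) bond_in_seq_maps:
  assumes "is_sequence K X f" "n \<le> m"
  shows "bond K X f n m \<in> seq_maps K X f"
  using assms(2)
proof (induction m rule: dec_induct)
  case base
  have "bond K X f n n = Ident K (X n)" by (cases n) auto
  then show ?case by (simp add: seq_maps.Ident)
next
  case (step m)
  have f: "f m \<in> Hom K (X (Suc m)) (X m)" using assms(1) by (auto simp: is_sequence_def)
  have "Ident K (X (Suc m)) \<in> Hom K (X (Suc m)) (X (Suc m))"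
    using assms(1) Ident_Hom by (auto simp: is_sequence_def)
  then have "f m \<cdot> Ident K (X (Suc m)) \<in> seq_maps K X f"
    by (intro seq_maps.Comp seq_maps.Ident) (auto simp: Hom_def)
  then have "f m \<in> seq_maps K X f" using Comp_Ident_right[OF f] by simp
  moreover have "Cod K (f m) = Dom K (bond K X f n m)"
    using f bond_Hom[OF assms(1) step.hyps(1)] by (auto simp: Hom_def)
  ultimately show ?case using seq_maps_Comp[OF assms(1) step.IH] step.hyps by auto
qed

context MU_category
begin

lemma fraisse_sequence_imp_directed:
  assumes "fraisse_sequence K X f"
  shows "directed_category K"
  unfolding directed_category_def
proof (intro ballI)
  fix Y Z assume "Y \<in> Ob K" "Z \<in> Ob K"
  then obtain m n p q where pq: "p \<in> Hom K (X m) Y" "q \<in> Hom K (X n) Z"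
    using assms unfolding fraisse_sequence_def seq_cofinal_def by blast
  let ?k = "max m n"
  have "is_sequence K X f" using assms by (simp add: fraisse_sequence_def)
  then have "bond K X f m ?k \<in> Hom K (X ?k) (X m)" "bond K X f n ?k \<in> Hom K (X ?k) (X n)"
    using bond_Hom by auto
  then have "p \<cdot> bond K X f m ?k \<in> Hom K (X ?k) Y" "q \<cdot> bond K X f n ?k \<in> Hom K (X ?k) Z"
    using pq Comp_Hom by blast+
  then show "\<exists>W\<in>Ob K. \<exists>f g. f \<in> Hom K W Y \<and> g \<in> Hom K W Z"
    using Hom_ObD(1) by blast
qed

text \<open>Projectivity speaks only of maps that start at an object of the sequence. Cofinality
  gives a map \<open>p\<close> from such an object to \<open>X\<close>, and projectivity is applied
  to \<open>f\<close> after \<open>p\<close>.\<close>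

lemma fraisse_sequence_imp_amalgamation:
  assumes "fraisse_sequence K S s"
  shows "amalgamation_property K"
  unfolding amalgamation_property_def
proof (intro allI impI ballI)
  fix \<epsilon> :: real and X Y Z f g
  assume \<epsilon>: "\<epsilon> > 0" and X: "X \<in> Ob K" and f: "f \<in> Hom K X Z" and g: "g \<in> Hom K Y Z"
  obtain n p where p: "p \<in> Hom K (S n) X"
    using assms X unfolding fraisse_sequence_def seq_cofinal_def by blast
  have fp: "f \<cdot> p \<in> Hom K (S n) Z" using Comp_Hom p f by blast
  have seq: "is_sequence K S s" and proj: "seq_projective K S s"
    using assms by (auto simp: fraisse_sequence_def)
  obtain m g' where m: "m \<ge> n" and g': "g' \<in> Hom K (S m) Y"
    and approx: "approx K \<epsilon> ((f \<cdot> p) \<cdot> bond K S s n m) (g \<cdot> g')"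
    using proj \<epsilon> Hom_ObD[OF g] fp g unfolding seq_projective_def by meson
  have b: "bond K S s n m \<in> Hom K (S m) (S n)" using bond_Hom[OF seq m] .
  have "p \<cdot> bond K S s n m \<in> Hom K (S m) X" using Comp_Hom b p by blast
  moreover have "approx K \<epsilon> (f \<cdot> (p \<cdot> bond K S s n m)) (g \<cdot> g')"
    using approx Comp_assoc[OF b p f] by simp
  ultimately show "\<exists>W\<in>Ob K. \<exists>f'\<in>Hom K W X. \<exists>g'\<in>Hom K W Y. approx K \<epsilon> (f \<cdot> f') (g \<cdot> g')"
    using g' Hom_ObD(1) by blast
qed

lemma fraisse_sequence_imp_dominating:
  assumes "fraisse_sequence K X f"
  shows "dominating_subcategory K (range X) (seq_maps K X f)"
proof -
  have seq: "is_sequence K X f" and cofin: "seq_cofinal K X" and absorb: "seq_absorbing K X f"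
    using assms by (auto simp: fraisse_sequence_def)
  have hom: "\<exists>m n. h \<in> Hom K (X m) (X n)" if "h \<in> seq_maps K X f" for h
    using seq_maps_Hom[OF seq that] .
  have "subcategory K (range X) (seq_maps K X f)"
    unfolding subcategory_def
  proof (intro conjI ballI impI)
    show "range X \<subseteq> Ob K" using seq by (auto simp: is_sequence_def)
    show "seq_maps K X f \<subseteq> Mor K" using hom by (fastforce simp: Hom_def)
    show "Dom K h \<in> range X" "Cod K h \<in> range X" if "h \<in> seq_maps K X f" for h
      using hom[OF that] by (auto simp: Hom_def)
    show "Ident K Y \<in> seq_maps K X f" if "Y \<in> range X" for Y
      using that by (auto intro: seq_maps.Ident)
    show "h \<cdot> g \<in> seq_maps K X f"
      if "g \<in> seq_maps K X f" "h \<in> seq_maps K X f" "Cod K g = Dom K h" for g h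
      using seq_maps_Comp[OF seq] that by blast
  qed
  moreover have "subcat_cofinal K (range X)"
    using cofin by (auto simp: seq_cofinal_def subcat_cofinal_def)
  moreover have "subcat_absorbing K (range X) (seq_maps K X f)"
    unfolding subcat_absorbing_def
  proof (intro ballI allI impI)
    fix X' \<epsilon> Y g
    assume "X' \<in> range X" "(\<epsilon>::real) > 0" "Y \<in> Ob K" "g \<in> Hom K Y X'"
    then obtain n m h where "X' = X n" "m \<ge> n" and h: "h \<in> Hom K (X m) Y"
      "approx K \<epsilon> (g \<cdot> h) (bond K X f n m)"
      using absorb unfolding seq_absorbing_def by blast
    \<comment> \<open>The map that absorption approximates is itself a bonding map, hence the
      required map of the subcategory.\<close>
    then have "bond K X f n m \<in> Hom K (X m) X' \<inter> seq_maps K X f"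
      using bond_Hom[OF seq] bond_in_seq_maps[OF seq] by auto
    then show "\<exists>Z\<in>Ob K. \<exists>g'\<in>Hom K Z Y. \<exists>h\<in>Hom K Z X' \<inter> seq_maps K X f. approx K \<epsilon> (g \<cdot> g') h"
      using h Hom_ObD(1) by blast
  qed
  ultimately show ?thesis by (simp add: dominating_subcategory_def)
qed

lemma fraisse_sequence_imp_fraisse_category:
  assumes "fraisse_sequence K X f"
  shows "fraisse_MU_category K"
proof -
  have "X 0 \<in> Ob K" using assms by (auto simp: fraisse_sequence_def is_sequence_def)
  then show ?thesis
    unfolding fraisse_MU_category_def
    using MU_category_axioms fraisse_sequence_imp_directed[OF assms]
      fraisse_sequence_imp_amalgamation[OF assms] fraisse_sequence_imp_dominating[OF assms]
      countable_seq_maps by blast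
qed


section \<open>From a Fraisse category to a Fraisse sequence\<close>

text \<open>Amalgamating \<open>p\<close> and \<open>g\<close> yields legs \<open>p'\<close> and
  \<open>q\<close> from some \<open>W\<close>. Absorption of \<open>p'\<close> gives a map
  \<open>h\<close> into \<open>W\<close> that makes \<open>p'\<close> after \<open>h\<close> nearly
  a bonding map, and \<open>q\<close> after \<open>h\<close> is the map sought.\<close>

lemma absorbing_imp_projective:
  assumes seq: "is_sequence K X f" and absorb: "seq_absorbing K X f"
    and amalg: "amalgamation_property K"
  shows "seq_projective K X f"
  unfolding seq_projective_def
proof (intro allI impI ballI)
  fix \<epsilon> :: real and n Y Z p g
  assume \<epsilon>: "\<epsilon> > 0" and p: "p \<in> Hom K (X n) Z" and g: "g \<in> Hom K Y Z"
  then have \<epsilon>2: "\<epsilon> / 2 > 0" by simp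
  obtain W p' q where p': "p' \<in> Hom K W (X n)" and q: "q \<in> Hom K W Y"
    and pq: "approx K (\<epsilon> / 2) (p \<cdot> p') (g \<cdot> q)"
    using amalg \<epsilon>2 p g Hom_ObD[OF p] Hom_ObD[OF g]
    unfolding amalgamation_property_def by meson
  \<comment> \<open>Composing with \<open>p\<close> on the left may expand distances. The modulus
    \<delta> is uniform over all domains, so it can be fixed before the stage \<open>m\<close> is
    known.\<close>
  obtain \<delta> where \<delta>: "\<delta> > 0"
    "\<And>W g h. \<lbrakk>g \<in> Hom K W (X n); h \<in> Hom K W (X n); approx K \<delta> g h\<rbrakk>
      \<Longrightarrow> approx K (\<epsilon> / 2) (p \<cdot> g) (p \<cdot> h)"
    using approx_comp_left[OF p \<epsilon>2] by blast
  obtain m h where m: "m \<ge> n" and h: "h \<in> Hom K (X m) W"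
    and approx_h: "approx K \<delta> (p' \<cdot> h) (bond K X f n m)"
    using absorb \<delta>(1) p' Hom_ObD(1)[OF p'] unfolding seq_absorbing_def by meson
  have b: "bond K X f n m \<in> Hom K (X m) (X n)" using bond_Hom[OF seq m] .
  have p'h: "p' \<cdot> h \<in> Hom K (X m) (X n)" using Comp_Hom h p' by blast
  have qh: "q \<cdot> h \<in> Hom K (X m) Y" using Comp_Hom h q by blast
  have pp': "p \<cdot> p' \<in> Hom K W Z" using Comp_Hom p' p by blast
  have gq: "g \<cdot> q \<in> Hom K W Z" using Comp_Hom q g by blast
  have "approx K (\<epsilon> / 2) (p \<cdot> bond K X f n m) (p \<cdot> (p' \<cdot> h))"
    using \<delta>(2)[OF b p'h] approx_sym[OF p'h b approx_h] by blast
  moreover have "approx K (\<epsilon> / 2) (p \<cdot> (p' \<cdot> h)) (g \<cdot> (q \<cdot> h))"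
    using approx_comp_right[OF h pp' gq pq] Comp_assoc[OF h p' p] Comp_assoc[OF h q g] by simp
  ultimately have "approx K (\<epsilon> / 2 + \<epsilon> / 2) (p \<cdot> bond K X f n m) (g \<cdot> (q \<cdot> h))"
    using approx_trans[OF Comp_Hom[OF b p] Comp_Hom[OF p'h p] Comp_Hom[OF qh g]] \<epsilon>2 by blast
  then show "\<exists>n'\<ge>n. \<exists>g'\<in>Hom K (X n') Y. approx K \<epsilon> (p \<cdot> bond K X f n n') (g \<cdot> g')"
    using m qh by auto
qed

lemma absorbing_imp_cofinal:
  assumes "is_sequence K X f" "seq_absorbing K X f" "directed_category K"
  shows "seq_cofinal K X"
  unfolding seq_cofinal_def
proof
  fix Y assume "Y \<in> Ob K"
  moreover have "X 0 \<in> Ob K" using assms(1) by (simp add: is_sequence_def)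
  ultimately obtain Z p q where p: "p \<in> Hom K Z (X 0)" and q: "q \<in> Hom K Z Y"
    using assms(3) unfolding directed_category_def by meson
  \<comment> \<open>Only the existence of a map into \<open>Z\<close> matters; the tolerance is
    taken to be 1.\<close>
  obtain n h where "h \<in> Hom K (X n) Z"
    using assms(2) p Hom_ObD(1)[OF p] zero_less_one unfolding seq_absorbing_def by meson
  then show "\<exists>n g. g \<in> Hom K (X n) Y" using Comp_Hom q by blast
qed

text \<open>Domination replaces \<open>g\<close>, after some \<open>q\<close>, by a nearby
  \<open>h\<close> in \<open>M\<close>. A map \<open>t\<close> that absorbs \<open>h\<close> then
  makes \<open>q\<close> after \<open>t\<close> absorb \<open>g\<close>, since precomposing with
  \<open>t\<close> does not enlarge the first error.\<close>

lemma absorbing_subcat_imp_absorbing: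
  assumes seq: "is_sequence K X f" and XA: "\<And>n. X n \<in> A"
    and dom: "subcat_absorbing K A M"
    and absorb: "\<And>n j h. \<lbrakk>h \<in> M; Cod K h = X n\<rbrakk> \<Longrightarrow>
      \<exists>m\<ge>n. \<exists>t\<in>Hom K (X m) (Dom K h). approx K (1 / real (Suc j)) (h \<cdot> t) (bond K X f n m)"
  shows "seq_absorbing K X f"
  unfolding seq_absorbing_def
proof (intro allI impI ballI)
  fix n \<epsilon> Y g
  assume \<epsilon>: "(\<epsilon>::real) > 0" and Y: "Y \<in> Ob K" and g: "g \<in> Hom K Y (X n)"
  have \<epsilon>2: "\<epsilon> / 2 > 0" using \<epsilon> by simp
  obtain Z q h where q: "q \<in> Hom K Z Y" and h: "h \<in> Hom K Z (X n)" "h \<in> M"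
    and gq: "approx K (\<epsilon> / 2) (g \<cdot> q) h"
    using dom XA[of n] \<epsilon>2 Y g unfolding subcat_absorbing_def by (metis IntE)
  obtain j where j: "inverse (real (Suc j)) < \<epsilon> / 2" using reals_Archimedean[OF \<epsilon>2] by blast
  obtain m t where m: "m \<ge> n" and t: "t \<in> Hom K (X m) Z"
    and "approx K (1 / real (Suc j)) (h \<cdot> t) (bond K X f n m)"
    using absorb[of h n j] h by (auto simp: Hom_def)
  moreover have "ennreal (1 / real (Suc j)) \<le> ennreal (\<epsilon> / 2)"
    using j by (intro ennreal_leI) (simp add: inverse_eq_divide)
  ultimately have ht: "approx K (\<epsilon> / 2) (h \<cdot> t) (bond K X f n m)"
    unfolding approx_def by (meson order_less_le_trans)
  have "g \<cdot> q \<in> Hom K Z (X n)" using Comp_Hom q g by blast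
  then have "approx K (\<epsilon> / 2) (g \<cdot> (q \<cdot> t)) (h \<cdot> t)"
    using approx_comp_right[OF t _ h(1) gq] Comp_assoc[OF t q g] by simp
  moreover have qt: "q \<cdot> t \<in> Hom K (X m) Y" using Comp_Hom t q by blast
  ultimately have "approx K (\<epsilon> / 2 + \<epsilon> / 2) (g \<cdot> (q \<cdot> t)) (bond K X f n m)"
    using approx_trans[OF Comp_Hom[OF qt g] Comp_Hom[OF t h(1)] bond_Hom[OF seq m]] ht \<epsilon>2
    by blast
  then show "\<exists>n'\<ge>n. \<exists>h\<in>Hom K (X n') Y. approx K \<epsilon> (g \<cdot> h) (bond K X f n n')"
    using m qt by auto
qed

text \<open>An amalgam of \<open>h\<close> and \<open>b\<close> is precomposed with a map from an
  object of \<open>A\<close>. This keeps the sequence inside \<open>A\<close> and does not increase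
  the error.\<close>

lemma absorb_step:
  assumes amalg: "amalgamation_property K" and cofin: "subcat_cofinal K A"
    and \<epsilon>: "\<epsilon> > 0" and b: "b \<in> Hom K X Z" and h: "h \<in> Hom K Y Z"
  shows "\<exists>X'\<in>A. \<exists>f\<in>Hom K X' X. \<exists>t\<in>Hom K X' Y. approx K \<epsilon> (h \<cdot> t) (b \<cdot> f)"
proof -
  obtain W u v where u: "u \<in> Hom K W Y" and v: "v \<in> Hom K W X"
    and uv: "approx K \<epsilon> (h \<cdot> u) (b \<cdot> v)"
    using amalg \<epsilon> b h Hom_ObD[OF b] Hom_ObD[OF h]
    unfolding amalgamation_property_def by meson
  obtain X' y where X': "X' \<in> A" and y: "y \<in> Hom K X' W"
    using cofin Hom_ObD(1)[OF u] unfolding subcat_cofinal_def by blast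
  have "approx K \<epsilon> ((h \<cdot> u) \<cdot> y) ((b \<cdot> v) \<cdot> y)"
    using approx_comp_right[OF y Comp_Hom[OF u h] Comp_Hom[OF v b] uv] .
  then have "approx K \<epsilon> (h \<cdot> (u \<cdot> y)) (b \<cdot> (v \<cdot> y))"
    using Comp_assoc[OF y u h] Comp_assoc[OF y v b] by simp
  then show ?thesis using X' Comp_Hom[OF y u] Comp_Hom[OF y v] by blast
qed

text \<open>
  The state of the recursion at stage \<open>k\<close> is \<open>(X, b)\<close>, where \<open>X\<close> is the current object and
  \<open>b n\<close>, for \<open>n \<le> k\<close>, is the bonding map from \<open>X\<close> to the \<open>n\<close>-th object, recovered as
  \<open>Cod K (b n)\<close>. Stage \<open>k\<close> serves the requirement \<open>(n, i, j)\<close> coded by \<open>k\<close>; the code satisfies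
  \<open>n \<le> k\<close>, so that \<open>b n\<close> is available.
\<close>

lemma exists_absorbing_sequence:
  assumes ne: "Ob K \<noteq> {}" and amalg: "amalgamation_property K"
    and sub: "subcategory K A M" and cofin: "subcat_cofinal K A" and countable: "countable M"
  obtains X f where "is_sequence K X f" "\<And>n. X n \<in> A"
    "\<And>n j h. \<lbrakk>h \<in> M; Cod K h = X n\<rbrakk> \<Longrightarrow>
      \<exists>m\<ge>n. \<exists>t\<in>Hom K (X m) (Dom K h). approx K (1 / real (Suc j)) (h \<cdot> t) (bond K X f n m)"
proof -
  obtain A0 where A0: "A0 \<in> A" using ne cofin by (auto simp: subcat_cofinal_def)
  have AOb: "A \<subseteq> Ob K" and MMor: "M \<subseteq> Mor K"
    using sub by (auto simp: subcategory_def)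
  define P where "P k s \<longleftrightarrow>
      fst s \<in> A \<and> (\<forall>n\<le>k. snd s n \<in> Mor K \<and> Dom K (snd s n) = fst s) \<and> snd s k = Ident K (fst s)"
    for k :: nat and s :: "'o \<times> (nat \<Rightarrow> 'm)"
  \<comment> \<open>The premises make the requirement vacuous when the coded map does not end at the
    \<open>n\<close>-th object.\<close>
  define goal where "goal n h j s f \<longleftrightarrow> h \<in> M \<longrightarrow> Cod K h = Cod K (snd s n) \<longrightarrow>
      (\<exists>t\<in>Hom K (Dom K f) (Dom K h). approx K (1 / real (Suc j)) (h \<cdot> t) (snd s n \<cdot> f))"
    for n h j f and s :: "'o \<times> (nat \<Rightarrow> 'm)"
  \<comment> \<open>The new bonding map \<open>f\<close> is hidden in the existential, to be chosen
    for all stages at once after the recursion. Each \<open>k\<close> codes exactly one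
    triple.\<close>
  define Q where "Q k s s' \<longleftrightarrow> (\<exists>f\<in>Hom K (fst s') (fst s).
      (\<forall>n\<le>k. snd s' n = snd s n \<cdot> f) \<and>
      (\<forall>n i j. k = prod_encode (n, prod_encode (i, j)) \<longrightarrow> goal n (from_nat_into M i) j s f))"
    for k :: nat and s s' :: "'o \<times> (nat \<Rightarrow> 'm)"
  have "\<exists>s. P 0 s"
    using A0 AOb Ident_Hom by (intro exI[of _ "(A0, \<lambda>_. Ident K A0)"]) (auto simp: P_def Hom_def)
  moreover have "\<exists>s'. P (Suc k) s' \<and> Q k s s'" if Ps: "P k s" for k s
  proof -
    obtain n i j where k: "k = prod_encode (n, prod_encode (i, j))"
      by (metis prod_decode_inverse surj_pair)
    define h where "h = from_nat_into M i"
    have nk: "n \<le> k" unfolding k by (rule le_prod_encode_1)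
    have X: "fst s \<in> A" using Ps by (simp add: P_def)
    have b: "snd s l \<in> Hom K (fst s) (Cod K (snd s l))" if "l \<le> k" for l
      using Ps that by (auto simp: P_def Hom_def)
    have "\<exists>X'\<in>A. \<exists>f\<in>Hom K X' (fst s). goal n h j s f"
    proof (cases "h \<in> M \<and> Cod K h = Cod K (snd s n)")
      case True
      then have "h \<in> Hom K (Dom K h) (Cod K (snd s n))" using MMor by (auto simp: Hom_def)
      then obtain X' f t where "X' \<in> A" "f \<in> Hom K X' (fst s)" "t \<in> Hom K X' (Dom K h)"
        "approx K (1 / real (Suc j)) (h \<cdot> t) (snd s n \<cdot> f)"
        using absorb_step[OF amalg cofin _ b[OF nk], of "1 / real (Suc j)" h "Dom K h"] by auto
      then show ?thesis by (auto simp: goal_def Hom_def)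
    next
      \<comment> \<open>Nothing is required at this stage, so the sequence is prolonged by the
        identity of the current object.\<close>
      case False
      then show ?thesis using X AOb Ident_Hom by (auto simp: goal_def)
    qed
    then obtain X' f where X': "X' \<in> A" and f: "f \<in> Hom K X' (fst s)" and goal: "goal n h j s f"
      by blast
    \<comment> \<open>At \<open>l = Suc k\<close> the default value is the identity that
      \<open>P (Suc k)\<close> demands; beyond that it is junk.\<close>
    define s' where "s' = (X', \<lambda>l. if l \<le> k then snd s l \<cdot> f else Ident K X')"
    have "Ident K X' \<in> Hom K X' X'" using X' AOb Ident_Hom by blast
    moreover have "snd s l \<cdot> f \<in> Hom K X' (Cod K (snd s l))" if "l \<le> k" for l
      using Comp_Hom f b that by blast
    ultimately have "P (Suc k) s'" using X' by (auto simp: P_def s'_def Hom_def)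
    moreover have "Q k s s'"
      unfolding Q_def using f goal k by (intro bexI[of _ f]) (auto simp: s'_def h_def)
    ultimately show ?thesis by blast
  qed
  ultimately obtain s where P: "\<And>k. P k (s k)" and Q: "\<And>k. Q k (s k) (s (Suc k))"
    using dependent_nat_choice[of P Q] by blast
  define X where "X = (\<lambda>k. fst (s k))"
  obtain f where f: "\<And>k. f k \<in> Hom K (X (Suc k)) (X k)"
    and sf: "\<And>k n. n \<le> k \<Longrightarrow> snd (s (Suc k)) n = snd (s k) n \<cdot> f k"
    and goal: "\<And>k n i j. k = prod_encode (n, prod_encode (i, j)) \<Longrightarrow>
      goal n (from_nat_into M i) j (s k) (f k)"
    using Q unfolding Q_def X_def by metis
  have XA: "X n \<in> A" for n using P by (auto simp: P_def X_def)
  have seq: "is_sequence K X f" using XA AOb f by (auto simp: is_sequence_def)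
  \<comment> \<open>The recorded maps obey the recursion of \<open>bond\<close>: \<open>P\<close>
    gives the identity at \<open>k = n\<close>, and \<open>sf\<close> the successor step.\<close>
  have bond: "bond K X f n k = snd (s k) n" if "n \<le> k" for n k
    using that
  proof (induction k rule: dec_induct)
    case base
    have "bond K X f n n = Ident K (X n)" by (cases n) auto
    then show ?case using P[of n] by (simp add: P_def X_def)
  next
    case (step k)
    then show ?case using sf by simp
  qed
  show thesis
  proof (rule that[OF seq XA])
    fix n j h assume h: "h \<in> M" "Cod K h = X n"
    \<comment> \<open>As \<open>M\<close> is countable, \<open>from_nat_into\<close> recovers
      \<open>h\<close> from its code. Stage \<open>k\<close> thus serves this very requirement, and
      the absorbing map starts at \<open>X (Suc k)\<close>.\<close>
    define k where "k = prod_encode (n, prod_encode (to_nat_on M h, j))"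
    have nk: "n \<le> k" unfolding k_def by (rule le_prod_encode_1)
    have "Cod K (snd (s k) n) = X n"
      using bond_Hom[OF seq nk] bond[OF nk] by (simp add: Hom_def)
    moreover have "goal n h j (s k) (f k)"
      using goal[OF k_def] h(1) countable by simp
    ultimately obtain t where "t \<in> Hom K (X (Suc k)) (Dom K h)"
      "approx K (1 / real (Suc j)) (h \<cdot> t) (bond K X f n (Suc k))"
      using h f[of k] nk bond[OF nk] by (auto simp: goal_def Hom_def)
    then show "\<exists>m\<ge>n. \<exists>t\<in>Hom K (X m) (Dom K h).
        approx K (1 / real (Suc j)) (h \<cdot> t) (bond K X f n m)"
      using nk le_Suc_eq by blast
  qed
qed

lemma fraisse_category_imp_fraisse_sequence:
  assumes "fraisse_MU_category K"
  shows "\<exists>X f. fraisse_sequence K X f"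
proof -
  obtain A M where ne: "Ob K \<noteq> {}" and dir: "directed_category K"
    and amalg: "amalgamation_property K" and M: "countable M" "subcategory K A M"
      "subcat_cofinal K A" "subcat_absorbing K A M"
    using assms by (auto simp: fraisse_MU_category_def dominating_subcategory_def)
  obtain X f where seq: "is_sequence K X f" and XA: "\<And>n. X n \<in> A"
    and req: "\<And>n j h. \<lbrakk>h \<in> M; Cod K h = X n\<rbrakk> \<Longrightarrow>
      \<exists>m\<ge>n. \<exists>t\<in>Hom K (X m) (Dom K h). approx K (1 / real (Suc j)) (h \<cdot> t) (bond K X f n m)"
    using exists_absorbing_sequence[OF ne amalg M(2,3,1)] by blast
  have "seq_absorbing K X f"
    using absorbing_subcat_imp_absorbing[OF seq XA M(4) req] by blast
  then show ?thesis
    using seq absorbing_imp_cofinal absorbing_imp_projective dir amalg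
    unfolding fraisse_sequence_def by blast
qed

end

theorem theorem4p47:
  fixes K :: "('o, 'm) mucat"
  assumes "MU_category K"
  shows "(\<exists>X f. fraisse_sequence K X f) \<longleftrightarrow> fraisse_MU_category K"
  using MU_category.fraisse_sequence_imp_fraisse_category[OF assms]
    MU_category.fraisse_category_imp_fraisse_sequence[OF assms] by blast

end
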